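(* Let $X$ be a complex Hilbert space, let $T$ be a closed Hermitian subspace in $X^2$, and let $S$ be a symmetric operator in $X$ (that is, a densely defined Hermitian operator) with $D(T)\subset D(S)$. If there exists $a\ge 0$ such that $$\|S(x)\|\le a\|x\|+\|T(x)\|,\qquad x\in D(T),$$ then $d_+(T+S)\le d_+(T)$ and $d_-(T+S)\le d_-(T)$.
   Context: A subspace (linear relation) in $X^2=X\times X$ is a linear subspace $T\subset X\times X$; it is closed if it is a closed subset of $X^2$. Domain: $D(T)=\{x:(x,f)\in T\text{ for some }f\in X\}$; range: $R(T)=\{f:(x,f)\in T\text{ for some }x\in X\}$; $T(x)=\{f\in X:(x,f)\in T\}$. For $\alpha\in\mathbf{C}$, $\alpha T=\{(x,\alpha f):(x,f)\in T\}$; $T+S=\{(x,f+g):(x,f)\in T,(x,g)\in S\}$; $I=\{(x,x):x\in X\}$. A linear operator in $X$ (defined on a linear subspace of $X$) is identified with its graph; a subspace $S$ is an operator iff $S(0)=\{0\}$. The adjoint is $T^*=\{(y,g)\in X^2:\langle g,x\rangle=\langle y,f\rangle\text{ for all }(x,f)\in T\}$. $T$ is Hermitian if $T\subset T^*$ (no density of the domain is assumed). Norm at a point: for $x\in D(T)$, $\|T(x)\|$ is the norm in the quotient space $X/\overline{T(0)}$ of the class of any $f\in T(x)$; equivalently $\|T(x)\|=\mathrm{dist}(f,T(0))$ for any $f\in T(x)$. For an operator this is the usual norm of the image. Deficiency indices of a Hermitian subspace $T$: $d_{\pm}(T)=\dim R(T\mp iI)^{\perp}$, with values in $\{0,1,2,\dots\}\cup\{+\infty\}$.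 *)

theory Defs
  imports "HOL-Analysis.Analysis" "HOL-Library.Extended_Nat"
begin

section \<open>Complex Hilbert spaces\<close>

class scaleC =
  fixes scaleC :: "complex \<Rightarrow> 'a \<Rightarrow> 'a"  (infixr \<open>*\<^sub>C\<close> 75)

class complex_vector = real_vector + scaleC +
  assumes scaleC_add_right: "c *\<^sub>C (x + y) = c *\<^sub>C x + c *\<^sub>C y"
    and scaleC_add_left: "(c + d) *\<^sub>C x = c *\<^sub>C x + d *\<^sub>C x"
    and scaleC_scaleC: "c *\<^sub>C d *\<^sub>C x = (c * d) *\<^sub>C x"
    and scaleR_scaleC: "r *\<^sub>R x = complex_of_real r *\<^sub>C x"

global_interpretation complex_vector: vector_space "scaleC :: complex \<Rightarrow> 'a \<Rightarrow> 'a::complex_vector"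
proof
  show "1 *\<^sub>C x = x" for x :: 'a
    using scaleR_scaleC[of 1 x] by simp
qed (rule scaleC_add_right scaleC_add_left scaleC_scaleC)+

instantiation prod :: (complex_vector, complex_vector) complex_vector
begin

definition scaleC_prod_def: "c *\<^sub>C p = (c *\<^sub>C fst p, c *\<^sub>C snd p)"

instance
  by standard (auto simp: scaleC_prod_def prod_eq_iff scaleC_add_right scaleC_add_left
      scaleC_scaleC scaleR_scaleC)

end

text \<open>
  Every complex inner product space is also a real one, with real inner product
  \<open>Re \<langle>x, y\<rangle>\<close> and the same norm and topology. Building on \<open>real_inner\<close> therefore loses no
  generality. Positive definiteness and the relation between norm and inner product are
  inherited, see \<open>cinner_self\<close> below. The form is linear in its first argument.
\<close>

class complex_inner = complex_vector + real_inner +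
  fixes cinner :: "'a \<Rightarrow> 'a \<Rightarrow> complex"
  assumes cinner_add_left: "cinner (x + y) z = cinner x z + cinner y z"
    and cinner_scaleC_left: "cinner (c *\<^sub>C x) y = c * cinner x y"
    and cinner_commute: "cinner x y = cnj (cinner y x)"
    and inner_eq_Re_cinner: "inner x y = Re (cinner x y)"

class chilbert_space = complex_inner + complete_space

lemma cinner_self: "cinner x x = complex_of_real ((norm x)\<^sup>2)"
proof (rule complex_eqI)
  show "Re (cinner x x) = Re (complex_of_real ((norm x)\<^sup>2))"
    by (simp flip: inner_eq_Re_cinner add: power2_norm_eq_inner)
  show "Im (cinner x x) = Im (complex_of_real ((norm x)\<^sup>2))"
    using cinner_commute[of x x] by (auto simp: complex_eq_iff)
qed

instantiation complex :: chilbert_space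
begin

definition scaleC_complex_def: "c *\<^sub>C (z::complex) = c * z"
definition cinner_complex_def: "cinner (w::complex) z = w * cnj z"

instance
  by standard (auto simp: scaleC_complex_def cinner_complex_def algebra_simps
      scaleR_conv_of_real inner_complex_def)

end

definition orth_compl :: "'a::complex_inner set \<Rightarrow> 'a set" where
  "orth_compl V = {y. \<forall>x\<in>V. cinner y x = 0}"

text \<open>
  The complex dimension of a subspace, valued in \<open>enat\<close>. The case distinction is needed because
  the library's \<open>dim\<close> is \<open>0\<close> on infinite-dimensional spaces.
\<close>

definition edim :: "'a::complex_vector set \<Rightarrow> enat" where
  "edim V = (if \<exists>B. finite B \<and> V \<subseteq> complex_vector.span B
             then enat (complex_vector.dim V) else \<infinity>)"


section \<open>Linear relations\<close>

text \<open>
  A linear relation is a set \<open>T :: ('a \<times> 'a) set\<close> with \<open>complex_vector.subspace T\<close>.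
  The notions \<open>D(T)\<close>, \<open>R(T)\<close>, \<open>T(x)\<close> and \<open>I\<close> are \<^const>\<open>Domain\<close> \<open>T\<close>, \<^const>\<open>Range\<close> \<open>T\<close>,
  \<open>T `` {x}\<close> and \<^const>\<open>Id\<close>. Operators, possibly defined on a proper subspace, are identified
  with their graphs.
\<close>

definition rel_scale :: "complex \<Rightarrow> ('a::complex_vector \<times> 'a) set \<Rightarrow> ('a \<times> 'a) set" where
  "rel_scale c T = {(x, c *\<^sub>C f) | x f. (x, f) \<in> T}"

definition rel_plus :: "('a::complex_vector \<times> 'a) set \<Rightarrow> ('a \<times> 'a) set \<Rightarrow> ('a \<times> 'a) set" where
  "rel_plus T S = {(x, f + g) | x f g. (x, f) \<in> T \<and> (x, g) \<in> S}"

definition rel_adjoint :: "('a::complex_inner \<times> 'a) set \<Rightarrow> ('a \<times> 'a) set" where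
  "rel_adjoint T = {(y, g). \<forall>(x, f)\<in>T. cinner g x = cinner y f}"

definition hermitian_rel :: "('a::complex_inner \<times> 'a) set \<Rightarrow> bool" where
  "hermitian_rel T \<longleftrightarrow> complex_vector.subspace T \<and> T \<subseteq> rel_adjoint T"

definition is_operator :: "('a::complex_vector \<times> 'a) set \<Rightarrow> bool" where
  "is_operator S \<longleftrightarrow> complex_vector.subspace S \<and> S `` {0} = {0}"

definition symmetric_operator :: "('a::complex_inner \<times> 'a) set \<Rightarrow> bool" where
  "symmetric_operator S \<longleftrightarrow> is_operator S \<and> hermitian_rel S \<and> closure (Domain S) = UNIV"

text \<open>
  The norm of the class of \<open>f\<close> in the quotient by a closed subspace \<open>N\<close>, the class being the
  coset \<open>{g. g - f \<in> N}\<close>.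
\<close>

definition quotient_norm :: "'a::real_normed_vector set \<Rightarrow> 'a \<Rightarrow> real" where
  "quotient_norm N f = Inf (norm ` {g. g - f \<in> N})"

text \<open>
  \<open>\<parallel>T(x)\<parallel>\<close>, meaningful for \<open>x\<close> in the domain. By \<open>norm_at_eq_infdist\<close> the choice of the
  representative \<open>f \<in> T(x)\<close> is irrelevant.
\<close>

definition norm_at :: "('a::complex_inner \<times> 'a) set \<Rightarrow> 'a \<Rightarrow> real" where
  "norm_at T x = quotient_norm (closure (T `` {0})) (SOME f. f \<in> T `` {x})"

definition deficiency_plus :: "('a::complex_inner \<times> 'a) set \<Rightarrow> enat" where
  "deficiency_plus T = edim (orth_compl (Range (rel_plus T (rel_scale (- \<i>) Id))))"

definition deficiency_minus :: "('a::complex_inner \<times> 'a) set \<Rightarrow> enat" where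
  "deficiency_minus T = edim (orth_compl (Range (rel_plus T (rel_scale \<i> Id))))"

lemma subspace_relD:
  assumes "complex_vector.subspace T"
  shows "(0, 0) \<in> T"
    and "(x, f) \<in> T \<Longrightarrow> (y, g) \<in> T \<Longrightarrow> (x + y, f + g) \<in> T"
    and "(x, f) \<in> T \<Longrightarrow> (y, g) \<in> T \<Longrightarrow> (x - y, f - g) \<in> T"
    and "(x, f) \<in> T \<Longrightarrow> (c *\<^sub>C x, c *\<^sub>C f) \<in> T"
  using complex_vector.subspace_0[OF assms]
    complex_vector.subspace_add[OF assms, of "(x, f)" "(y, g)"]
    complex_vector.subspace_diff[OF assms, of "(x, f)" "(y, g)"]
    complex_vector.subspace_scale[OF assms, of "(x, f)" c]
  by (auto simp: zero_prod_def scaleC_prod_def)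

lemma norm_at_eq_infdist:
  assumes T: "complex_vector.subspace T" and f: "f \<in> T `` {x}"
  shows "norm_at T x = infdist f (T `` {0})"
proof -
  define M where "M = T `` {0}"
  define h where "h = (SOME f. f \<in> T `` {x})"
  have h: "h \<in> T `` {x}" unfolding h_def using f by (rule someI)
  have M: "0 \<in> M" "\<And>u v. u \<in> M \<Longrightarrow> v \<in> M \<Longrightarrow> u + v \<in> M" "\<And>u v. u \<in> M \<Longrightarrow> v \<in> M \<Longrightarrow> u - v \<in> M"
    using subspace_relD[OF T] by (fastforce simp: M_def)+
  have fh: "f - h \<in> M"
    using subspace_relD(3)[OF T, of x f x h] f h by (simp add: M_def)
  have diff: "v - u \<in> closure M" if u: "u \<in> M" and v: "v \<in> closure M" for u v
  proof -
    have "(\<lambda>w. w - u) ` closure M \<subseteq> closure M"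
      by (rule image_closure_subset)
        (auto intro!: continuous_intros closure_subset[THEN subsetD] M(3) u)
    with v show ?thesis by auto
  qed
  have "norm ` {g. g - h \<in> closure M} = dist f ` closure M"
  proof (intro equalityI subsetI)
    fix r assume "r \<in> norm ` {g. g - h \<in> closure M}"
    then obtain g where g: "g - h \<in> closure M" "r = norm g" by auto
    have "(\<lambda>w. (f - h) - w) ` closure M \<subseteq> closure M"
      by (rule image_closure_subset)
        (auto intro!: continuous_intros closure_subset[THEN subsetD] M(3) fh)
    then have "(f - h) - (g - h) \<in> closure M" using g by blast
    moreover have "r = dist f ((f - h) - (g - h))" using g by (simp add: dist_norm)
    ultimately show "r \<in> dist f ` closure M" by blast
  next
    fix r assume "r \<in> dist f ` closure M"
    then obtain m where m: "m \<in> closure M" "r = norm (f - m)" by (auto simp: dist_norm)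
    have "m - (f - h) \<in> closure M" using diff fh m by blast
    moreover have "uminus ` closure M \<subseteq> closure M"
      by (rule image_closure_subset)
        (use M(1) M(3)[OF M(1)] in \<open>auto intro!: continuous_intros closure_subset[THEN subsetD]\<close>)
    ultimately have "- (m - (f - h)) \<in> closure M" by blast
    then have "(f - m) - h \<in> closure M" by (simp add: algebra_simps)
    with m show "r \<in> norm ` {g. g - h \<in> closure M}" by blast
  qed
  moreover have "closure M \<noteq> {}" using M(1) closure_subset by blast
  ultimately have "norm_at T x = infdist f (closure M)"
    unfolding norm_at_def quotient_norm_def infdist_def h_def[symmetric] M_def[symmetric]
    by simp
  then show ?thesis
    by (simp add: M_def infdist_eq_setdist setdist_closure_2)
qed

lemma norm_at_operator:
  assumes "is_operator S" "(x, f) \<in> S"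
  shows "norm_at S x = norm f"
  using assms norm_at_eq_infdist[of S f x] by (auto simp: is_operator_def)

end

theory Submission
  imports Defs
begin

text \<open>
  Fix \<open>c = \<plusminus>\<i>\<close> and let \<open>N\<^sub>t\<close> be the orthogonal complement of the range of \<open>T + tS + cI\<close>, so that
  \<open>dim N\<^sub>0\<close> and \<open>dim N\<^sub>1\<close> are the deficiency indices to be compared. The perturbation has relative
  bound \<open>1\<close>, so \<open>t = 1\<close> can only be reached as a limit.

  For \<open>t < 1\<close> and \<open>w = (T + tS + cI)x\<close>, hermiticity gives \<open>\<parallel>x\<parallel> \<le> \<parallel>w\<parallel>\<close>, and absorbing \<open>t\<parallel>Sx\<parallel>\<close> in
  the relative bound gives \<open>(1 - t)\<parallel>Sx\<parallel> \<le> (a + 1)\<parallel>w\<parallel>\<close> (\<open>resolvent_estimate\<close>). If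
  \<open>dim N\<^bsub>t'\<^esub> > dim N\<^sub>t\<close>, then a dimension count and the projection theorem give a unit vector
  \<open>u \<in> N\<^bsub>t'\<^esub>\<close> that is a limit of such \<open>w\<close>; being orthogonal to \<open>w + (t' - t)Sx\<close>, it satisfies
  \<open>|\<langle>u, (t' - t)Sx\<rangle>| \<approx> 1\<close> (\<open>excess_vector\<close>). This is used twice.

  For \<open>t' = t + (1 - t)/(a + 2)\<close> the estimate bounds the same quantity by about
  \<open>(a + 1)/(a + 2) < 1\<close>, which is absurd. Hence \<open>dim N\<^bsub>t'\<^esub> \<le> dim N\<^sub>t\<close> (\<open>edim_defect_step\<close>), and iterating
  gives \<open>t\<^sub>k\<close> increasing to \<open>1\<close> with \<open>dim N\<^bsub>t\<^sub>k\<^esub> \<le> dim N\<^sub>0\<close>.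

  For \<open>t' = 1\<close> and \<open>t = t\<^sub>k\<close> the vectors \<open>\<psi>\<^sub>k = (1 - t\<^sub>k)Sx\<^sub>k\<close> are merely bounded. As in Wuest's
  theorem on essential self-adjointness, they tend weakly to zero, because \<open>S\<close> is symmetric with
  dense domain (\<open>weak_null\<close>). If \<open>dim N\<^sub>1 > dim N\<^sub>0\<close>, then \<open>dim N\<^sub>0\<close> is finite, and the unit vectors
  \<open>u\<^sub>k\<close> can all be taken from one finite-dimensional subspace of \<open>N\<^sub>1\<close>. There weak convergence is
  uniform, so \<open>\<langle>u\<^sub>k, \<psi>\<^sub>k\<rangle> \<rightarrow> 0\<close>, a contradiction.
\<close>


section \<open>Complex inner products\<close>

lemma cinner_add_right: "cinner x (y + z) = cinner x y + cinner x (z::'a::complex_inner)"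
  by (metis cinner_add_left cinner_commute complex_cnj_add)

lemma cinner_scaleC_right: "cinner x (c *\<^sub>C y) = cnj c * cinner x (y::'a::complex_inner)"
  by (metis cinner_scaleC_left cinner_commute complex_cnj_mult)

lemma cinner_zero_left [simp]: "cinner 0 (x::'a::complex_inner) = 0"
  using cinner_add_left[of 0 0 x] by simp

lemma cinner_zero_right [simp]: "cinner (x::'a::complex_inner) 0 = 0"
  using cinner_add_right[of x 0 0] by simp

lemma cinner_diff_left: "cinner (x - y) z = cinner x z - cinner y (z::'a::complex_inner)"
  using cinner_add_left[of "x - y" y z] by simp

lemma cinner_diff_right: "cinner x (y - z) = cinner x y - cinner x (z::'a::complex_inner)"
  using cinner_add_right[of x "y - z" z] by simp

lemma cinner_sum_left: "cinner (sum f A) z = (\<Sum>a\<in>A. cinner (f a) (z::'a::complex_inner))"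
  by (induction A rule: infinite_finite_induct) (auto simp: cinner_add_left)

lemma cinner_eq_zero_commute: "cinner x y = 0 \<longleftrightarrow> cinner y (x::'a::complex_inner) = 0"
  by (metis cinner_commute complex_cnj_zero)

lemma norm_scaleC: "norm (c *\<^sub>C x) = cmod c * norm (x::'a::complex_inner)"
proof -
  have "complex_of_real ((norm (c *\<^sub>C x))\<^sup>2) = complex_of_real ((cmod c * norm x)\<^sup>2)"
    using cinner_self[of "c *\<^sub>C x"]
    by (simp add: cinner_scaleC_left cinner_scaleC_right cinner_self[of x] power_mult_distrib
        complex_norm_square ac_simps del: of_real_power)
  then show ?thesis
    by (metis of_real_eq_iff norm_ge_zero mult_nonneg_nonneg power2_eq_iff_nonneg)
qed

lemma cmod_cinner_le: "cmod (cinner x y) \<le> norm x * norm (y::'a::complex_inner)"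
proof (cases "cinner x y = 0")
  case False
  \<comment> \<open>Rotating \<open>x\<close> by a phase makes the product real, which reduces the claim to the
     Cauchy-Schwarz inequality of the underlying real space.\<close>
  define c where "c = cnj (cinner x y) / cmod (cinner x y)"
  have "c * cinner x y = complex_of_real (cmod (cinner x y))"
    using False complex_norm_square[of "cinner x y"]
    by (simp add: c_def field_simps power2_eq_square)
  then have "cmod (cinner x y) = inner (c *\<^sub>C x) y"
    by (simp add: inner_eq_Re_cinner cinner_scaleC_left)
  also have "\<dots> \<le> norm (c *\<^sub>C x) * norm y" by (rule norm_cauchy_schwarz)
  also have "norm (c *\<^sub>C x) = norm x" using False by (simp add: norm_scaleC c_def norm_divide)
  finally show ?thesis .
qed simp

lemma subspace_orth_compl: "complex_vector.subspace (orth_compl V)"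
  by (rule complex_vector.subspaceI)
    (auto simp: orth_compl_def cinner_add_left cinner_scaleC_left)


section \<open>The double orthogonal complement\<close>

text \<open>
  The projection theorem in the form in which it is used: the distance of \<open>x\<close> to \<open>R\<close> is attained
  at some \<open>p\<close> in the closure, since by the parallelogram law a minimising sequence is Cauchy.
  By minimality \<open>x - p\<close> is orthogonal to \<open>R\<close>, hence to \<open>x\<close> and to \<open>p\<close>, hence to itself.
\<close>

lemma orth_compl_orth_compl_subset_closure:
  fixes R :: "'a::chilbert_space set"
  assumes R: "complex_vector.subspace R"
  shows "orth_compl (orth_compl R) \<subseteq> closure R"
proof
  fix x assume x: "x \<in> orth_compl (orth_compl R)"
  have R0: "0 \<in> R" and Radd: "\<And>u v. u \<in> R \<Longrightarrow> v \<in> R \<Longrightarrow> u + v \<in> R"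
    and Rsc: "\<And>c u. u \<in> R \<Longrightarrow> c *\<^sub>C u \<in> R"
    using R by (auto simp: complex_vector.subspace_def)
  have Rsr: "r *\<^sub>R u \<in> R" if "u \<in> R" for r u
    using Rsc[OF that] by (simp add: scaleR_scaleC)
  define d where "d = infdist x R"
  have d_le: "d \<le> norm (x - r)" if "r \<in> R" for r
    using infdist_le[OF that, of x] by (simp add: d_def dist_norm)
  have d0: "0 \<le> d" by (simp add: d_def infdist_nonneg)
  have "\<exists>r\<in>R. norm (x - r) < d + 1 / Suc n" for n
  proof -
    have "d < d + 1 / Suc n" by simp
    moreover have "d = Inf (dist x ` R)" using R0 by (auto simp: d_def infdist_def)
    moreover have "bdd_below (dist x ` R)" by (rule bdd_belowI[of _ 0]) auto
    ultimately have "\<exists>r\<in>R. dist x r < d + 1 / Suc n"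
      using cInf_lessD[of "dist x ` R" "d + 1 / Suc n"] R0 by auto
    then show ?thesis by (simp add: dist_norm)
  qed
  then obtain r where rR: "\<And>n. r n \<in> R" and r: "\<And>n. norm (x - r n) < d + 1 / Suc n"
    by metis
  have para: "(norm (r m - r n))\<^sup>2 \<le> (8 * d + 4) / Suc N" if "N \<le> m" "N \<le> n" for m n N
  proof -
    have near: "(norm (x - r k))\<^sup>2 \<le> d\<^sup>2 + (2 * d + 1) / Suc N" if "N \<le> k" for k
    proof -
      have k: "1 / Suc k \<le> 1 / Suc N" using that by (simp add: frac_le)
      have N1: "1 / Suc N * (1 / Suc N) \<le> 1 / Suc N * 1"
        by (rule mult_left_mono) auto
      have "(norm (x - r k))\<^sup>2 \<le> (d + 1 / Suc N)\<^sup>2"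
        using r[of k] k by (intro power_mono) auto
      also have "\<dots> = d\<^sup>2 + 2 * d / Suc N + 1 / Suc N * (1 / Suc N)"
        by (simp add: power2_eq_square algebra_simps)
      also have "\<dots> \<le> d\<^sup>2 + 2 * d / Suc N + 1 / Suc N" using N1 by simp
      finally show ?thesis by (simp add: add_divide_distrib)
    qed
    have mid: "d\<^sup>2 \<le> (norm (x - (1/2) *\<^sub>R (r m + r n)))\<^sup>2"
      using d_le[OF Rsr[OF Radd[OF rR rR]]] d0 by (intro power_mono) auto
    have "(norm (r m - r n))\<^sup>2 = 2 * (norm (x - r m))\<^sup>2 + 2 * (norm (x - r n))\<^sup>2
        - 4 * (norm (x - (1/2) *\<^sub>R (r m + r n)))\<^sup>2"
      by (simp add: power2_norm_eq_inner inner_simps inner_commute field_simps)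
    also have "\<dots> \<le> 4 * ((2 * d + 1) / Suc N)"
      using near[OF that(1)] near[OF that(2)] mid by linarith
    also have "\<dots> = (8 * d + 4) / Suc N" by (simp add: field_simps)
    finally show ?thesis .
  qed
  have "Cauchy r"
  proof (rule metric_CauchyI)
    fix e :: real assume e: "0 < e"
    obtain N where N: "(8 * d + 4) / e\<^sup>2 < real N" using reals_Archimedean2 by blast
    have "(8 * d + 4) / Suc N < e\<^sup>2"
      using N e by (simp add: field_simps) (smt (verit) zero_less_power)
    then have "dist (r m) (r n) < e" if "N \<le> m" "N \<le> n" for m n
      using para[OF that] e by (smt (verit) dist_norm power_less_imp_less_base)
    then show "\<exists>M. \<forall>m\<ge>M. \<forall>n\<ge>M. dist (r m) (r n) < e" by blast
  qed
  then obtain p where p: "r \<longlonglongrightarrow> p" by (auto simp: Cauchy_convergent_iff convergent_def)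
  define y where "y = x - p"
  have y_le: "norm y \<le> norm (y - u)" if u: "u \<in> R" for u
  proof -
    have "norm y \<le> d"
    proof (rule LIMSEQ_le)
      show "(\<lambda>n. norm (x - r n)) \<longlonglongrightarrow> norm y" unfolding y_def by (intro tendsto_intros p)
      show "(\<lambda>n. d + 1 / Suc n) \<longlonglongrightarrow> d"
        using tendsto_add[OF tendsto_const LIMSEQ_inverse_real_of_nat, of d]
        by (simp add: inverse_eq_divide)
    qed (use r less_imp_le in blast)
    also have "d \<le> norm (y - u)"
    proof (rule LIMSEQ_le_const)
      show "(\<lambda>n. norm (x - (r n + u))) \<longlonglongrightarrow> norm (y - u)"
        unfolding y_def diff_diff_eq by (intro tendsto_intros p)
    qed (use d_le Radd rR u in blast)
    finally show ?thesis .
  qed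
  have inner0: "inner y u = 0" if u: "u \<in> R" for u
  proof (cases "u = 0")
    case False
    define t where "t = inner y u / (norm u)\<^sup>2"
    have "(norm y)\<^sup>2 \<le> (norm (y - t *\<^sub>R u))\<^sup>2" using y_le[OF Rsr[OF u]] by (intro power_mono) auto
    also have "\<dots> = (norm y)\<^sup>2 - (inner y u)\<^sup>2 / (norm u)\<^sup>2"
      using False unfolding t_def power2_norm_eq_inner
      by (simp add: inner_simps inner_commute field_simps power2_eq_square)
    finally have "(inner y u)\<^sup>2 / (norm u)\<^sup>2 \<le> 0" by simp
    then show ?thesis using False by (simp add: divide_le_0_iff)
  qed simp
  have "cinner y u = 0" if u: "u \<in> R" for u
    using inner0[OF u] inner0[OF Rsc[OF u, of \<i>]]
    by (simp add: inner_eq_Re_cinner cinner_scaleC_right complex_eq_iff)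
  then have "y \<in> orth_compl R" by (simp add: orth_compl_def)
  then have "inner x y = 0" using x by (simp add: orth_compl_def inner_eq_Re_cinner)
  moreover have "inner y p = 0"
  proof (rule LIMSEQ_unique)
    show "(\<lambda>n. inner y (r n)) \<longlonglongrightarrow> inner y p" by (intro tendsto_intros p)
    show "(\<lambda>n. inner y (r n)) \<longlonglongrightarrow> 0" using inner0 rR by simp
  qed
  ultimately have "inner y y = 0" by (simp add: y_def inner_simps inner_commute)
  then have "x = p" by (simp add: y_def)
  then show "x \<in> closure R" using p rR closure_sequential by blast
qed


section \<open>Orthonormal sets and dimension\<close>

definition orthonormal :: "'a::complex_inner set \<Rightarrow> bool" where
  "orthonormal E \<longleftrightarrow> finite E \<and> (\<forall>e\<in>E. \<forall>f\<in>E. cinner e f = (if e = f then 1 else 0))"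

lemma orthonormal_sum_cinner:
  assumes E: "orthonormal E" and e: "e \<in> E"
  shows "cinner (\<Sum>f\<in>E. c f *\<^sub>C f) e = c e"
proof -
  have "cinner (\<Sum>f\<in>E. c f *\<^sub>C f) e = (\<Sum>f\<in>E. if f = e then c f else 0)"
    unfolding cinner_sum_left cinner_scaleC_left
    using E e by (intro sum.cong) (auto simp: orthonormal_def)
  then show ?thesis using E e by (simp add: orthonormal_def)
qed

lemma orthonormal_expansion:
  assumes E: "orthonormal E" and u: "u \<in> complex_vector.span E"
  shows "u = (\<Sum>e\<in>E. cinner u e *\<^sub>C e)"
proof -
  obtain c where c: "u = (\<Sum>e\<in>E. c e *\<^sub>C e)"
    using u E by (auto simp: complex_vector.span_finite orthonormal_def)
  show ?thesis using orthonormal_sum_cinner[OF E, of _ c] by (simp flip: c)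
qed

lemma orthonormal_independent:
  assumes E: "orthonormal E"
  shows "complex_vector.independent E"
proof (rule complex_vector.independent_if_scalars_zero)
  show "finite E" using E by (simp add: orthonormal_def)
  show "c e = 0" if "(\<Sum>f\<in>E. c f *\<^sub>C f) = 0" "e \<in> E" for c e
    using orthonormal_sum_cinner[OF E that(2), of c] that(1) by simp
qed

text \<open>
  A functional that is small on an orthonormal set is uniformly small on the unit ball of its span.
  This takes the place of a compactness argument in the finite-dimensional span.
\<close>

lemma orthonormal_cmod_cinner_le:
  assumes E: "orthonormal E" and u: "u \<in> complex_vector.span E"
  shows "cmod (cinner u v) \<le> norm u * (\<Sum>e\<in>E. cmod (cinner e v))"
proof -
  have "cinner u v = (\<Sum>e\<in>E. cinner u e * cinner e v)"
    using arg_cong[OF orthonormal_expansion[OF E u], of "\<lambda>w. cinner w v"]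
    by (simp add: cinner_sum_left cinner_scaleC_left)
  then have "cmod (cinner u v) \<le> (\<Sum>e\<in>E. cmod (cinner u e) * cmod (cinner e v))"
    by (simp add: norm_mult[symmetric] norm_sum)
  also have "\<dots> \<le> (\<Sum>e\<in>E. norm u * cmod (cinner e v))"
  proof (intro sum_mono mult_right_mono)
    fix e assume "e \<in> E"
    then have "(norm e)\<^sup>2 = 1"
      using E cinner_self[of e] by (simp add: orthonormal_def flip: of_real_power)
    then have "norm e = 1" by (simp add: power2_eq_1_iff) (use norm_ge_zero[of e] in linarith)
    then show "cmod (cinner u e) \<le> norm u" using cmod_cinner_le[of u e] by simp
  qed simp
  finally show ?thesis by (simp add: sum_distrib_left)
qed

lemma orthonormal_extend:
  assumes E: "orthonormal E" and EN: "E \<subseteq> N" and N: "complex_vector.subspace N"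
    and x: "x \<in> N" "x \<notin> complex_vector.span E"
  obtains e where "e \<in> N" "e \<notin> E" "orthonormal (insert e E)"
proof -
  define q where "q = (\<Sum>e\<in>E. cinner x e *\<^sub>C e)"
  have q: "q \<in> complex_vector.span E" unfolding q_def
    by (intro complex_vector.span_sum complex_vector.span_scale complex_vector.span_base)
  have "complex_vector.span E \<subseteq> N" using EN N by (rule complex_vector.span_minimal)
  with q have qN: "q \<in> N" by blast
  define y where "y = x - q"
  have y0: "y \<noteq> 0" using q x by (auto simp: y_def)
  define e where "e = complex_of_real (1 / norm y) *\<^sub>C y"
  have eN: "e \<in> N" unfolding e_def y_def
    by (intro complex_vector.subspace_scale[OF N] complex_vector.subspace_diff[OF N] x qN)
  have ort: "cinner e f = 0" if "f \<in> E" for f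
    using orthonormal_sum_cinner[OF E that, of "\<lambda>e. cinner x e"]
    by (simp add: e_def y_def cinner_scaleC_left cinner_diff_left q_def)
  have ee: "cinner e e = 1"
    using y0 by (simp add: cinner_self e_def norm_scaleC norm_divide)
  have "e \<notin> E" using ort[of e] ee by auto
  moreover have "orthonormal (insert e E)"
    using E ort ee cinner_eq_zero_commute[of e] by (auto simp: orthonormal_def)
  ultimately show ?thesis using that eN by blast
qed

lemma orthonormal_subset_exists:
  assumes N: "complex_vector.subspace N" and m: "enat m \<le> edim N"
  shows "\<exists>E\<subseteq>N. orthonormal E \<and> card E = m"
  using m
proof (induction m)
  case 0
  show ?case by (rule exI[of _ "{}"]) (simp add: orthonormal_def)
next
  case (Suc m)
  have "enat m \<le> edim N" using Suc.prems by (meson enat_ord_simps(1) le_SucI order.refl order_trans)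
  then obtain E where E: "E \<subseteq> N" "orthonormal E" "card E = m" using Suc.IH by blast
  have fin: "finite E" using E by (simp add: orthonormal_def)
  have "\<not> N \<subseteq> complex_vector.span E"
  proof
    assume le: "N \<subseteq> complex_vector.span E"
    then have "complex_vector.dim N \<le> m" using complex_vector.dim_le_card[OF le fin] E by simp
    moreover have "edim N = enat (complex_vector.dim N)" using le fin by (auto simp: edim_def)
    ultimately show False using Suc.prems by simp
  qed
  then obtain x where "x \<in> N" "x \<notin> complex_vector.span E" by blast
  from orthonormal_extend[OF E(2,1) N this] obtain e
    where "e \<in> N" "e \<notin> E" "orthonormal (insert e E)" .
  then show ?case using E fin by (intro exI[of _ "insert e E"]) auto
qed

text \<open>
  The orthogonality conditions against a basis of \<open>N\<close> are fewer than the dimension of the span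
  of \<open>E\<close>, so they have a common nonzero solution in that span.
\<close>

lemma unit_vector_in_span_orth_compl:
  fixes N :: "'a::complex_inner set"
  assumes E: "orthonormal E" and less: "edim N < enat (card E)"
  shows "\<exists>u\<in>complex_vector.span E. norm u = 1 \<and> u \<in> orth_compl N"
proof -
  obtain B0 where B0: "finite B0" "N \<subseteq> complex_vector.span B0"
    and dim: "complex_vector.dim N < card E"
    using less by (auto simp: edim_def split: if_splits)
  obtain B where B: "B \<subseteq> N" "complex_vector.independent B" "N \<subseteq> complex_vector.span B"
    "card B = complex_vector.dim N"
    using complex_vector.basis_exists by blast
  have finB: "finite B"
    using complex_vector.independent_span_bound[OF B0(1) B(2)] B B0 by blast
  \<comment> \<open>The conditions packed into one linear map: as \<open>B\<close> is independent, \<open>p u = 0\<close> only if \<open>u\<close> is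
     orthogonal to \<open>B\<close>.\<close>
  define p :: "'a \<Rightarrow> 'a" where "p = (\<lambda>x. \<Sum>b\<in>B. cinner x b *\<^sub>C b)"
  interpret p: Vector_Spaces.linear scaleC scaleC p
    by unfold_locales
      (simp_all add: p_def cinner_add_left cinner_scaleC_left scaleC_add_left sum.distrib
        complex_vector.scale_sum_right scaleC_scaleC)
  have "\<exists>u\<in>complex_vector.span E. u \<noteq> 0 \<and> p u = 0"
  proof (rule ccontr)
    assume "\<not> ?thesis"
    then have "inj_on p (complex_vector.span E)"
      by (intro inj_onI) (metis complex_vector.span_diff eq_iff_diff_eq_0 p.diff)
    then have "complex_vector.independent (p ` E)" and inj: "inj_on p E"
      using p.independent_injective_image[OF orthonormal_independent[OF E]]
        inj_on_subset[OF _ complex_vector.span_superset] by blast+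
    moreover have "p ` E \<subseteq> complex_vector.span B"
      unfolding p_def
      by (intro image_subsetI complex_vector.span_sum complex_vector.span_scale
          complex_vector.span_base)
    ultimately have "card (p ` E) \<le> card B"
      using complex_vector.independent_span_bound[OF finB] by blast
    then show False using card_image[OF inj] B dim by simp
  qed
  then obtain u where u: "u \<in> complex_vector.span E" "u \<noteq> 0" "p u = 0" by blast
  have ub: "cinner u b = 0" if "b \<in> B" for b
    using complex_vector.independentD[OF B(2) finB order.refl, of "\<lambda>b. cinner u b" b] u that
    by (simp add: p_def)
  have "complex_vector.span B \<subseteq> {v. cinner u v = 0}"
    by (rule complex_vector.span_minimal)
      (auto simp: ub complex_vector.subspace_def cinner_add_right cinner_scaleC_right)
  then have "u \<in> orth_compl N" using B by (auto simp: orth_compl_def)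
  then have "complex_of_real (1 / norm u) *\<^sub>C u \<in> orth_compl N"
    using complex_vector.subspace_scale[OF subspace_orth_compl] by blast
  moreover have "norm (complex_of_real (1 / norm u) *\<^sub>C u) = 1"
    using u by (simp add: norm_scaleC norm_divide)
  ultimately show ?thesis using complex_vector.span_scale[OF u(1)] by blast
qed


section \<open>Relatively bounded perturbations\<close>

text \<open>
  Parametrised by the shift, so that the two deficiency indices are treated at once, and by the
  size \<open>t\<close> of the perturbation: this is the range of \<open>T + tS + cI\<close>.
\<close>

definition pert_range ::
    "('a::complex_inner \<times> 'a) set \<Rightarrow> ('a \<times> 'a) set \<Rightarrow> complex \<Rightarrow> real \<Rightarrow> 'a set" where
  "pert_range T S c t = {f + t *\<^sub>R s + c *\<^sub>C x | x f s. (x, f) \<in> T \<and> (x, s) \<in> S}"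

lemma pert_range_subspace:
  assumes T: "complex_vector.subspace T" and S: "complex_vector.subspace S"
  shows "complex_vector.subspace (pert_range T S c t)"
proof (rule complex_vector.subspaceI)
  show "0 \<in> pert_range T S c t"
    using subspace_relD(1)[OF T] subspace_relD(1)[OF S] by (force simp: pert_range_def)
next
  fix v w assume "v \<in> pert_range T S c t" "w \<in> pert_range T S c t"
  then obtain x f s y g r where "(x, f) \<in> T" "(x, s) \<in> S" "v = f + t *\<^sub>R s + c *\<^sub>C x"
    "(y, g) \<in> T" "(y, r) \<in> S" "w = g + t *\<^sub>R r + c *\<^sub>C y"
    by (auto simp: pert_range_def)
  moreover from this have "v + w = (f + g) + t *\<^sub>R (s + r) + c *\<^sub>C (x + y)"
    by (simp add: scaleC_add_right scaleR_add_right)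
  ultimately show "v + w \<in> pert_range T S c t"
    using subspace_relD(2)[OF T] subspace_relD(2)[OF S] unfolding pert_range_def by blast
next
  fix k v assume "v \<in> pert_range T S c t"
  then obtain x f s where "(x, f) \<in> T" "(x, s) \<in> S" "v = f + t *\<^sub>R s + c *\<^sub>C x"
    by (auto simp: pert_range_def)
  moreover from this have "k *\<^sub>C v = k *\<^sub>C f + t *\<^sub>R (k *\<^sub>C s) + c *\<^sub>C (k *\<^sub>C x)"
    by (simp add: scaleC_add_right scaleR_scaleC scaleC_scaleC mult.commute)
  ultimately show "k *\<^sub>C v \<in> pert_range T S c t"
    using subspace_relD(4)[OF T] subspace_relD(4)[OF S] unfolding pert_range_def by blast
qed

lemma hermitian_cinner_real:
  assumes "hermitian_rel T" "(x, f) \<in> T"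
  shows "Im (cinner f x) = 0"
proof -
  have "cinner f x = cinner x f" using assms by (auto simp: hermitian_rel_def rel_adjoint_def)
  then show ?thesis using cinner_commute[of f x] by (simp add: complex_eq_iff)
qed

locale relatively_bounded =
  fixes T S :: "('a::chilbert_space \<times> 'a) set" and a :: real and c :: complex
  assumes T: "hermitian_rel T" and S: "hermitian_rel S"
    and S_dense: "closure (Domain S) = UNIV"
    and dom: "Domain T \<subseteq> Domain S"
    and a: "0 \<le> a"
    and bound: "(x, f) \<in> T \<Longrightarrow> (x, s) \<in> S \<Longrightarrow> norm s \<le> a * norm x + norm f"
    and c: "Re c = 0" "cmod c = 1"
begin

abbreviation "defect t \<equiv> orth_compl (pert_range T S c t)"

text \<open>
  Since \<open>\<langle>(T + tS)x, x\<rangle>\<close> is real and \<open>c\<close> is imaginary, \<open>w = (T + tS + c)x\<close> satisfies the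
  Pythagorean identity \<open>\<parallel>w\<parallel>\<^sup>2 = \<parallel>(T + tS)x\<parallel>\<^sup>2 + \<parallel>x\<parallel>\<^sup>2\<close>. For \<open>t < 1\<close> the relative bound is
  then absorbed: \<open>\<parallel>Sx\<parallel> \<le> a\<parallel>x\<parallel> + \<parallel>(T + tS)x\<parallel> + t\<parallel>Sx\<parallel>\<close>.
\<close>

lemma resolvent_estimate:
  assumes xf: "(x, f) \<in> T" and xs: "(x, s) \<in> S" and t: "0 \<le> t"
    and w: "w = f + t *\<^sub>R s + c *\<^sub>C x"
  shows "norm x \<le> norm w" and "(1 - t) * norm s \<le> (a + 1) * norm w"
proof -
  define g where "g = f + t *\<^sub>R s"
  have "Im (cinner g x) = 0"
    using hermitian_cinner_real[OF T xf] hermitian_cinner_real[OF S xs]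
    by (simp add: g_def cinner_add_left cinner_scaleC_left scaleR_scaleC)
  then have "inner g (c *\<^sub>C x) = 0"
    using c by (simp add: inner_eq_Re_cinner cinner_scaleC_right)
  then have eq: "(norm w)\<^sup>2 = (norm g)\<^sup>2 + (norm x)\<^sup>2"
    using c by (simp add: w g_def[symmetric] norm_add_Pythagorean orthogonal_def norm_scaleC)
  show x_le: "norm x \<le> norm w" by (rule power2_le_imp_le) (simp_all add: eq)
  have g_le: "norm g \<le> norm w" by (rule power2_le_imp_le) (simp_all add: eq)
  have "norm f \<le> norm g + t * norm s"
    using norm_triangle_ineq4[of g "t *\<^sub>R s"] t by (simp add: g_def)
  then have "(1 - t) * norm s \<le> a * norm x + norm g"
    using bound[OF xf xs] by (simp add: algebra_simps)
  also have "\<dots> \<le> a * norm w + norm w"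
    using x_le g_le a by (intro add_mono mult_left_mono)
  finally show "(1 - t) * norm s \<le> (a + 1) * norm w" by (simp add: algebra_simps)
qed

text \<open>
  An excess of dimension is exploited as follows: it provides a unit vector \<open>u\<close> that is orthogonal to
  the range at \<open>t'\<close> but lies in the closure of the range at \<open>t\<close>. For \<open>w\<close> in the latter range
  and near \<open>u\<close>, orthogonality of \<open>u\<close> to \<open>w + (t' - t)s\<close> bounds the perturbation from below.
\<close>

lemma excess_vector:
  assumes E: "orthonormal E" "E \<subseteq> defect t'" and less: "edim (defect t) < enat (card E)"
    and \<epsilon>: "0 < \<epsilon>"
  obtains u x f s w where "u \<in> complex_vector.span E" "norm u = 1"
    "(x, f) \<in> T" "(x, s) \<in> S" "w = f + t *\<^sub>R s + c *\<^sub>C x" "norm w < 1 + \<epsilon>"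
    "1 - \<epsilon> < cmod (cinner u ((t' - t) *\<^sub>R s))"
proof -
  obtain u where u: "u \<in> complex_vector.span E" "norm u = 1" "u \<in> orth_compl (defect t)"
    using unit_vector_in_span_orth_compl[OF E(1) less] by blast
  have "complex_vector.subspace (pert_range T S c t)"
    using T S by (simp add: pert_range_subspace hermitian_rel_def)
  then have "u \<in> closure (pert_range T S c t)"
    using u orth_compl_orth_compl_subset_closure by blast
  then obtain w where w: "w \<in> pert_range T S c t" "norm (u - w) < \<epsilon>"
    using \<epsilon> by (metis closure_approachable dist_norm norm_minus_commute)
  then obtain x f s where xfs: "(x, f) \<in> T" "(x, s) \<in> S" "w = f + t *\<^sub>R s + c *\<^sub>C x"
    by (auto simp: pert_range_def)
  have "u \<in> defect t'"
    using complex_vector.span_minimal[OF E(2) subspace_orth_compl] u(1) by blast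
  moreover have "f + t' *\<^sub>R s + c *\<^sub>C x \<in> pert_range T S c t'"
    using xfs by (auto simp: pert_range_def)
  ultimately have "cinner u (f + t' *\<^sub>R s + c *\<^sub>C x) = 0" by (simp add: orth_compl_def)
  moreover have "f + t' *\<^sub>R s + c *\<^sub>C x = w + (t' - t) *\<^sub>R s"
    by (simp add: xfs scaleR_left_diff_distrib)
  ultimately have "cinner u (w + (t' - t) *\<^sub>R s) = 0" by simp
  then have "cinner u ((t' - t) *\<^sub>R s) = - cinner u w"
    by (simp add: cinner_add_right eq_neg_iff_add_eq_0 add.commute)
  also have "\<dots> = cinner u (u - w) - 1" by (simp add: cinner_diff_right cinner_self u)
  finally have eq: "cinner u ((t' - t) *\<^sub>R s) = cinner u (u - w) - 1" .
  have "cmod (cinner u (u - w)) < \<epsilon>" using cmod_cinner_le[of u "u - w"] u w by simp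
  moreover have "1 - cmod (cinner u (u - w)) \<le> cmod (cinner u (u - w) - 1)"
    using norm_triangle_ineq2[of 1 "cinner u (u - w)"] by (simp add: norm_minus_commute)
  ultimately have "1 - \<epsilon> < cmod (cinner u ((t' - t) *\<^sub>R s))" using eq by simp
  moreover have "norm w < 1 + \<epsilon>"
    using norm_triangle_ineq4[of u "u - w"] u w by simp
  ultimately show ?thesis using that u xfs by blast
qed

lemma edim_defect_step:
  assumes t: "0 \<le> t" "t < 1"
  shows "edim (defect (t + (1 - t) / (a + 2))) \<le> edim (defect t)" (is "edim (defect ?t') \<le> _")
proof (rule ccontr)
  assume "\<not> ?thesis"
  then have less: "edim (defect t) < edim (defect ?t')" by simp
  then obtain n where n: "edim (defect t) = enat n" by (cases "edim (defect t)") auto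
  have "enat (Suc n) \<le> edim (defect ?t')" using less n by (simp add: Suc_ile_eq)
  then obtain E where E: "E \<subseteq> defect ?t'" "orthonormal E" "card E = Suc n"
    using orthonormal_subset_exists[OF subspace_orth_compl] by blast
  define q where "q = (a + 1) / (a + 2)"
  have q: "0 < q" "q < 1" using a by (auto simp: q_def)
  \<comment> \<open>The perturbation has relative size \<open>q < 1\<close>, and this choice of \<open>\<epsilon>\<close> gives
     \<open>q * (1 + \<epsilon>) = 1 - \<epsilon>\<close>.\<close>
  define \<epsilon> where "\<epsilon> = (1 - q) / (1 + q)"
  have \<epsilon>: "0 < \<epsilon>" "q * (1 + \<epsilon>) = 1 - \<epsilon>" using q by (auto simp: \<epsilon>_def field_simps)
  obtain u x f s w where *: "norm u = 1" "(x, f) \<in> T" "(x, s) \<in> S" "w = f + t *\<^sub>R s + c *\<^sub>C x"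
    "norm w < 1 + \<epsilon>" "1 - \<epsilon> < cmod (cinner u ((?t' - t) *\<^sub>R s))"
    using excess_vector[OF E(2,1), of t \<epsilon>] \<epsilon> n E(3) by (metis enat_ord_simps(2) lessI)
  have "cmod (cinner u ((?t' - t) *\<^sub>R s)) \<le> norm ((?t' - t) *\<^sub>R s)"
    using cmod_cinner_le[of u "(?t' - t) *\<^sub>R s"] * by simp
  also have "\<dots> = (1 - t) * norm s / (a + 2)" using t a by simp
  also have "\<dots> \<le> (a + 1) * norm w / (a + 2)"
    using resolvent_estimate(2)[OF *(2,3) t(1) *(4)] a by (intro divide_right_mono) auto
  also have "\<dots> = q * norm w" by (simp add: q_def)
  also have "\<dots> \<le> q * (1 + \<epsilon>)" using * q by (intro mult_left_mono) auto
  finally show False using * \<epsilon> by simp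
qed

text \<open>
  The iterates of the step \<open>t \<mapsto> t + (1 - t)/(a + 2)\<close> from \<open>0\<close>: the gap \<open>1 - t\<close> shrinks each time
  by the factor \<open>(a + 1)/(a + 2)\<close>.
\<close>

definition approach :: "nat \<Rightarrow> real" where
  "approach k = 1 - ((a + 1) / (a + 2)) ^ k"

lemma approach_bounds: "0 \<le> approach k" "approach k < 1"
  using a by (auto simp: approach_def power_le_one)

lemma edim_defect_approach: "edim (defect (approach k)) \<le> edim (defect 0)"
proof (induction k)
  case 0
  show ?case by (simp add: approach_def)
next
  case (Suc k)
  have "approach (Suc k) = approach k + (1 - approach k) / (a + 2)"
  proof -
    have q: "(a + 1) / (a + 2) = 1 - 1 / (a + 2)" using a by (simp add: field_simps)
    show ?thesis unfolding approach_def q power_Suc by (simp add: left_diff_distrib)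
  qed
  then show ?case using edim_defect_step[OF approach_bounds] Suc.IH by (metis order_trans)
qed

text \<open>
  On \<open>\<langle>y, (1 - t\<^sub>k)S(x\<^sub>k)\<rangle>\<close> with \<open>y\<close> in the domain of \<open>S\<close>, symmetry moves \<open>S\<close> to the fixed vector
  \<open>y\<close>, and the factor \<open>1 - t\<^sub>k\<close> wins. Boundedness extends this from the dense domain to every \<open>y\<close>.
\<close>

lemma weak_null:
  fixes x s :: "nat \<Rightarrow> 'a" and \<delta> :: "nat \<Rightarrow> real"
  assumes xs: "\<And>k. (x k, s k) \<in> S" and \<delta>: "\<delta> \<longlonglongrightarrow> 0"
    and x: "\<And>k. norm (x k) \<le> K" and s: "\<And>k. norm (\<delta> k *\<^sub>R s k) \<le> M"
  shows "(\<lambda>k. cinner y (\<delta> k *\<^sub>R s k)) \<longlonglongrightarrow> 0"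
proof (rule LIMSEQ_I)
  fix r :: real assume r: "0 < r"
  have M: "0 \<le> M" using s[of 0] norm_ge_zero order_trans by blast
  obtain z where z: "z \<in> Domain S" "dist z y < r / (2 * (M + 1))"
    using S_dense r M closure_approachable[of y "Domain S"]
    by (metis UNIV_I add_nonneg_pos divide_pos_pos mult_pos_pos zero_less_numeral zero_less_one)
  then obtain v where v: "(z, v) \<in> S" by blast
  have "(\<lambda>k. \<bar>\<delta> k\<bar> * (norm v * K)) \<longlonglongrightarrow> 0"
    using \<delta> by (intro tendsto_mult_left_zero tendsto_rabs_zero)
  then obtain k0 where k0: "\<And>k. k \<ge> k0 \<Longrightarrow> \<bar>\<delta> k\<bar> * (norm v * K) < r / 2"
    using r LIMSEQ_D[of _ 0 "r / 2"] by (smt (verit, best) half_gt_zero real_norm_def)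
  have "norm (cinner y (\<delta> k *\<^sub>R s k) - 0) < r" if k: "k \<ge> k0" for k
  proof -
    have "cinner z (s k) = cinner v (x k)"
      using S v xs[of k] by (fastforce simp: hermitian_rel_def rel_adjoint_def)
    then have "cmod (cinner z (\<delta> k *\<^sub>R s k)) = \<bar>\<delta> k\<bar> * cmod (cinner v (x k))"
      by (simp add: scaleR_scaleC cinner_scaleC_right norm_mult)
    also have "\<dots> \<le> \<bar>\<delta> k\<bar> * (norm v * K)"
      using order_trans[OF cmod_cinner_le mult_left_mono[OF x norm_ge_zero]]
      by (intro mult_left_mono) auto
    also have "\<dots> < r / 2" using k0 k by blast
    finally have 1: "cmod (cinner z (\<delta> k *\<^sub>R s k)) < r / 2" .
    have "cmod (cinner (y - z) (\<delta> k *\<^sub>R s k)) \<le> norm (y - z) * M"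
      using cmod_cinner_le[of "y - z" "\<delta> k *\<^sub>R s k"] s[of k]
      by (meson mult_left_mono norm_ge_zero order_trans)
    also have "\<dots> \<le> r / (2 * (M + 1)) * M"
      using z M by (intro mult_right_mono) (auto simp: dist_norm norm_minus_commute)
    also have "\<dots> \<le> r / 2" using M r by (simp add: field_simps)
    finally have 2: "cmod (cinner (y - z) (\<delta> k *\<^sub>R s k)) \<le> r / 2" .
    have "cinner y (\<delta> k *\<^sub>R s k) = cinner z (\<delta> k *\<^sub>R s k) + cinner (y - z) (\<delta> k *\<^sub>R s k)"
      by (simp add: cinner_diff_left)
    then show ?thesis using 1 2 norm_triangle_ineq[of "cinner z (\<delta> k *\<^sub>R s k)"]
      by (smt (verit) diff_zero field_sum_of_halves)
  qed
  then show "\<exists>k0. \<forall>k\<ge>k0. norm (cinner y (\<delta> k *\<^sub>R s k) - 0) < r" by blast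
qed

text \<open>
  The excess vectors for \<open>t' = 1\<close> and \<open>t = t\<^sub>k\<close> are all drawn from the span of one finite set \<open>E\<close>.
  That is what turns the weak convergence of \<open>(1 - t\<^sub>k)S(x\<^sub>k)\<close> into a contradiction with the
  lower bound \<open>1/2\<close>, although the \<open>u\<^sub>k\<close> vary.
\<close>

theorem edim_defect_le: "edim (defect 1) \<le> edim (defect 0)"
proof (rule ccontr)
  assume "\<not> ?thesis"
  then have less: "edim (defect 0) < edim (defect 1)" by simp
  then obtain n where n: "edim (defect 0) = enat n" by (cases "edim (defect 0)") auto
  have "enat (Suc n) \<le> edim (defect 1)" using less n by (simp add: Suc_ile_eq)
  then obtain E where E: "E \<subseteq> defect 1" "orthonormal E" "card E = Suc n"
    using orthonormal_subset_exists[OF subspace_orth_compl] by blast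
  have small: "edim (defect (approach k)) < enat (card E)" for k
    using edim_defect_approach[of k] n E(3)
    by (metis enat_ord_simps(2) lessI order_le_less_trans)
  have "\<forall>k. \<exists>u x f s w. u \<in> complex_vector.span E \<and> norm u = 1 \<and> (x, f) \<in> T \<and> (x, s) \<in> S \<and>
      w = f + approach k *\<^sub>R s + c *\<^sub>C x \<and> norm w < 1 + 1/2 \<and>
      1 - 1/2 < cmod (cinner u ((1 - approach k) *\<^sub>R s))" (is "\<forall>k. ?ex k")
  proof
    fix k
    show "?ex k"
      by (rule excess_vector[OF E(2,1) small, of "1/2" k]) (simp, blast)
  qed
  then obtain u x f s w where *: "\<forall>k. u k \<in> complex_vector.span E \<and> norm (u k) = 1 \<and>
      (x k, f k) \<in> T \<and> (x k, s k) \<in> S \<and>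
      w k = f k + approach k *\<^sub>R s k + c *\<^sub>C x k \<and> norm (w k) < 1 + 1/2 \<and>
      1 - 1/2 < cmod (cinner (u k) ((1 - approach k) *\<^sub>R s k))"
    unfolding choice_iff by blast
  then have u: "\<And>k. u k \<in> complex_vector.span E" "\<And>k. norm (u k) = 1"
    and xf: "\<And>k. (x k, f k) \<in> T" and xs: "\<And>k. (x k, s k) \<in> S"
    and w: "\<And>k. w k = f k + approach k *\<^sub>R s k + c *\<^sub>C x k" "\<And>k. norm (w k) < 1 + 1/2"
    and low: "\<And>k. 1 - 1/2 < cmod (cinner (u k) ((1 - approach k) *\<^sub>R s k))"
    by blast+
  have lim: "(\<lambda>k. 1 - approach k) \<longlonglongrightarrow> 0"
    using a by (simp add: approach_def LIMSEQ_power_zero)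
  have x2: "norm (x k) \<le> 2" for k
    using resolvent_estimate(1)[OF xf xs approach_bounds(1) w(1), of k] w(2)[of k] by simp
  have s2: "norm ((1 - approach k) *\<^sub>R s k) \<le> (a + 1) * 2" for k
  proof -
    have "norm ((1 - approach k) *\<^sub>R s k) = (1 - approach k) * norm (s k)"
      using approach_bounds(2)[of k] by simp
    also have "\<dots> \<le> (a + 1) * norm (w k)"
      by (rule resolvent_estimate(2)[OF xf xs approach_bounds(1) w(1)])
    also have "\<dots> \<le> (a + 1) * 2" using w(2)[of k] a by (intro mult_left_mono) auto
    finally show ?thesis .
  qed
  have "(\<lambda>k. \<Sum>e\<in>E. cmod (cinner e ((1 - approach k) *\<^sub>R s k))) \<longlonglongrightarrow> 0"
    by (intro tendsto_null_sum tendsto_norm_zero weak_null[OF xs lim x2 s2])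
  then obtain k where "(\<Sum>e\<in>E. cmod (cinner e ((1 - approach k) *\<^sub>R s k))) < 1/2"
    using order_tendstoD(2)[of _ 0 sequentially "1/2"]
    by (metis (mono_tags, lifting) eventually_sequentially half_gt_zero_iff order.refl zero_less_one)
  then show False
    using orthonormal_cmod_cinner_le[OF E(2) u(1), of k "(1 - approach k) *\<^sub>R s k"] u(2)[of k] low[of k]
    by simp
qed

end


section \<open>Deficiency indices\<close>

lemma pert_range_0:
  assumes "Domain T \<subseteq> Domain S"
  shows "pert_range T S c 0 = Range (rel_plus T (rel_scale c Id))"
  using assms by (fastforce simp: pert_range_def rel_plus_def rel_scale_def)

lemma pert_range_1: "pert_range T S c 1 = Range (rel_plus (rel_plus T S) (rel_scale c Id))"
  by (fastforce simp: pert_range_def rel_plus_def rel_scale_def)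

theorem theorem3p2:
  fixes T S :: "('a::chilbert_space \<times> 'a) set"
  assumes "closed T" and "hermitian_rel T"
    and "symmetric_operator S"
    and "Domain T \<subseteq> Domain S"
    and "\<exists>a\<ge>0. \<forall>x\<in>Domain T. norm_at S x \<le> a * norm x + norm_at T x"
  shows "deficiency_plus (rel_plus T S) \<le> deficiency_plus T
       \<and> deficiency_minus (rel_plus T S) \<le> deficiency_minus T"
proof -
  from assms(5) obtain a where a: "0 \<le> a"
    "\<And>x. x \<in> Domain T \<Longrightarrow> norm_at S x \<le> a * norm x + norm_at T x" by blast
  have bound: "norm s \<le> a * norm x + norm f" if "(x, f) \<in> T" "(x, s) \<in> S" for x f s
  proof -
    have subT: "complex_vector.subspace T" using assms(2) by (simp add: hermitian_rel_def)
    have "norm_at T x = infdist f (T `` {0})"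
      using norm_at_eq_infdist[OF subT] that by blast
    also have "\<dots> \<le> norm f"
      using infdist_le[of 0 "T `` {0}" f] subspace_relD(1)[OF subT] by simp
    finally show ?thesis
      using a(2)[of x] norm_at_operator[of S x s] that assms(3)
      by (force simp: symmetric_operator_def)
  qed
  have "relatively_bounded T S a c" if "Re c = 0" "cmod c = 1" for c
    using assms a bound that by unfold_locales (auto simp: symmetric_operator_def)
  then have "edim (orth_compl (Range (rel_plus (rel_plus T S) (rel_scale c Id))))
      \<le> edim (orth_compl (Range (rel_plus T (rel_scale c Id))))" if "Re c = 0" "cmod c = 1" for c
    using relatively_bounded.edim_defect_le[of T S a c] that
    by (simp add: pert_range_0[OF assms(4)] pert_range_1)
  from this[of "- \<i>"] this[of \<i>] show ?thesis
    by (simp add: deficiency_plus_def deficiency_minus_def)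
qed

end
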